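(* Let $q\in\mathbb{R}$ with $|q|>1/2$ and $q\neq 1$, and set $a=\frac{1}{2q}$. For every $n\in\mathbb{N}$, writing $k=\lfloor \log_2 n\rfloor$ and $u=\log_2 n-k\in[0,1)$, one has \[ \frac{1}{n}S_q(n)=\frac{q}{2}\left(\frac{1-q^{k+1}}{1-q}-q^{k}\,\hat F_q(u)\right), \qquad\text{where}\quad \hat F_q(u)=2^{1-u}\,\mathcal{T}_a\!\left(2^{-(1-u)}\right). \] Equivalently, $\frac{1}{n}S_q(n)=\frac{q}{2}\left(\frac{1-q^{\lfloor\log_2 n\rfloor+1}}{1-q}-q^{\lfloor\log_2 n\rfloor}\hat F_q(\log_2 n)\right)$, where $\hat F_q$ is the 1-periodic function equal to $2^{1-u}\mathcal{T}_a(2^{-(1-u)})$ for $u\in[0,1)$.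
   Context: For $k\in\mathbb{N}_0$ with binary expansion $k=\sum_{i\ge 0}\omega_i 2^i$, $\omega_i\in\{0,1\}$, define the $q$-weighted digit sum $s_q(k)=\sum_{i\ge0}\omega_i q^{i+1}$, and $S_q(n)=\sum_{k=0}^{n-1}s_q(k)$. Let $\tau(x)=\mathrm{dist}(x,\mathbb{Z})$ be the distance from $x\in\mathbb{R}$ to the nearest integer. For $|a|<1$ the Takagi–Landsberg function is $\mathcal{T}_a(x)=\sum_{m=0}^\infty a^m\tau(2^m x)$, $x\in\mathbb{R}$. $\lfloor\cdot\rfloor$ denotes the integer part. *)

theory Defs
  imports "HOL-Analysis.Analysis"
begin

(* The series has only finitely many nonzero terms; see q_digit_sum_eq_sum. *)
definition q_digit_sum :: "real \<Rightarrow> nat \<Rightarrow> real" where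
  "q_digit_sum q k = (\<Sum>i. of_bool (bit k i) * q ^ (i + 1))"

definition q_digit_sum_total :: "real \<Rightarrow> nat \<Rightarrow> real" where
  "q_digit_sum_total q n = (\<Sum>k<n. q_digit_sum q k)"

definition dist_to_int :: "real \<Rightarrow> real" where
  "dist_to_int x = infdist x \<int>"

(* Meaningful for \<bar>a\<bar> < 1, where the series converges; see takagi_landsberg_summable. *)
definition takagi_landsberg :: "real \<Rightarrow> real \<Rightarrow> real" where
  "takagi_landsberg a x = (\<Sum>m. a ^ m * dist_to_int (2 ^ m * x))"

(* frac makes the function 1-periodic; see F_hat_periodic and F_hat_eq. *)
definition F_hat :: "real \<Rightarrow> real \<Rightarrow> real" where
  "F_hat q x = 2 powr (1 - frac x) *
     takagi_landsberg (1 / (2 * q)) (2 powr (- (1 - frac x)))"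

lemma q_digit_sum_eq_sum: "q_digit_sum q k = (\<Sum>i<k. of_bool (bit k i) * q ^ (i + 1))"
  unfolding q_digit_sum_def
proof (rule suminf_finite)
  fix i assume "i \<notin> {..<k}"
  then have "k < 2 ^ i"
    by (meson lessThan_iff less_exp linorder_not_less order_le_less_trans)
  then show "of_bool (bit k i) * q ^ (i + 1) = 0"
    by (simp add: bit_iff_odd)
qed simp

lemma dist_to_int_bounds: "0 \<le> dist_to_int x" "dist_to_int x \<le> 1"
proof -
  show "0 \<le> dist_to_int x"
    by (simp add: dist_to_int_def infdist_nonneg)
  have "dist_to_int x \<le> dist x (of_int \<lfloor>x\<rfloor>)"
    unfolding dist_to_int_def by (rule infdist_le) simp
  also have "\<dots> \<le> 1"
    unfolding dist_real_def by linarith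
  finally show "dist_to_int x \<le> 1" .
qed

lemma takagi_landsberg_summable:
  assumes "\<bar>a\<bar> < 1"
  shows "summable (\<lambda>m. a ^ m * dist_to_int (2 ^ m * x))"
proof (rule summable_comparison_test')
  show "summable (\<lambda>m. \<bar>a\<bar> ^ m)"
    using assms by (simp add: summable_geometric)
  show "norm (a ^ m * dist_to_int (2 ^ m * x)) \<le> \<bar>a\<bar> ^ m" for m
    using dist_to_int_bounds[of "2 ^ m * x"]
    by (simp add: abs_mult power_abs mult_left_le)
qed

lemma F_hat_periodic: "F_hat q (x + 1) = F_hat q x"
  by (simp add: F_hat_def frac_1_eq)

lemma F_hat_eq:
  assumes "0 \<le> u" "u < 1"
  shows "F_hat q u = 2 powr (1 - u) * takagi_landsberg (1 / (2 * q)) (2 powr (- (1 - u)))"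
  using assms by (simp add: F_hat_def frac_eq)

end

(* Both sides split over the binary digits. Among 0, ..., n - 1 the j-th binary digit equals 1
   exactly n/2 - 2^j tau(n/2^(j+1)) times, because n \<mapsto> 2^(j+1) tau(n/2^(j+1)) is the zigzag
   that goes up by 1 when digit j of n is 0 and down by 1 when it is 1. Weighting by q^(j+1) and
   summing over j \<le> k gives a geometric sum minus the series of T_a at n/2^(k+1), reversed by
   j = k - m and cut off at m = k because tau vanishes on the integers. *)

theory Submission imports Defs begin

text \<open>The two candidates are the distances to \<open>\<lfloor>x\<rfloor>\<close> and
  \<open>\<lfloor>x\<rfloor> + 1\<close>. Every integer lies at or beyond one of these two
  neighbours of \<open>x\<close>, so none is closer.\<close>

lemma dist_to_int_eq_frac: "dist_to_int x = min (frac x) (1 - frac x)"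
proof (rule antisym)
  have "dist_to_int x \<le> dist x (of_int \<lfloor>x\<rfloor>)" "dist_to_int x \<le> dist x (of_int (\<lfloor>x\<rfloor> + 1))"
    unfolding dist_to_int_def by (intro infdist_le Ints_of_int)+
  then show "dist_to_int x \<le> min (frac x) (1 - frac x)"
    unfolding dist_real_def frac_def min_def by simp
  have "min (frac x) (1 - frac x) \<le> dist x y" if y: "y \<in> \<int>" for y
  proof -
    obtain z where z: "y = of_int z"
      using y by (elim Ints_cases)
    have "z \<le> \<lfloor>x\<rfloor> \<or> \<lfloor>x\<rfloor> + 1 \<le> z"
      by linarith
    then have "real_of_int z \<le> of_int \<lfloor>x\<rfloor> \<or> of_int \<lfloor>x\<rfloor> + 1 \<le> real_of_int z"
      by (metis of_int_1 of_int_add of_int_le_iff)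
    moreover have "of_int \<lfloor>x\<rfloor> \<le> x" "x < of_int \<lfloor>x\<rfloor> + 1"
      by linarith+
    ultimately show ?thesis
      unfolding z dist_real_def frac_def min_le_iff_disj by argo
  qed
  then show "min (frac x) (1 - frac x) \<le> dist_to_int x"
    unfolding dist_to_int_def by (subst infdist_notempty) (auto intro!: cINF_greatest)
qed

lemma dist_to_int_of_nat: "dist_to_int (of_nat n) = 0"
  by (simp add: dist_to_int_eq_frac frac_def)

text \<open>Reduces tau at a fraction with denominator \<open>M\<close> to the residue of the
  numerator, so that the later induction on \<open>n\<close> only has to follow
  \<open>n mod M\<close>.\<close>

lemma dist_to_int_divide_nat:
  assumes "M > 0"
  shows "dist_to_int (real n / real M) = min (real (n mod M)) (real M - real (n mod M)) / real M"
proof -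
  have "real n = real M * real (n div M) + real (n mod M)"
    by (metis mult_div_mod_eq of_nat_add of_nat_mult)
  then have "real n / real M = real (n mod M) / real M + of_int (int (n div M))"
    using assms by (simp add: field_simps)
  then have "frac (real n / real M) = frac (real (n mod M) / real M)"
    by (simp add: frac_def)
  also have "\<dots> = real (n mod M) / real M"
    using assms by (simp add: frac_eq)
  finally have frac: "frac (real n / real M) = real (n mod M) / real M" .
  have "1 - real (n mod M) / real M = (real M - real (n mod M)) / real M"
    using assms by (simp add: field_simps)
  then show ?thesis
    by (simp add: dist_to_int_eq_frac frac min_divide_distrib_right)
qed

text \<open>The residue is \<open>2 ^ j\<close> times digit \<open>j\<close> plus the lower digits,
  and these contribute less than \<open>2 ^ j\<close>.\<close>

lemma bit_iff_half_le_mod: "bit n j \<longleftrightarrow> 2 ^ j \<le> n mod 2 ^ Suc j" for n :: nat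
proof -
  have "n mod 2 ^ Suc j = 2 ^ j * (n div 2 ^ j mod 2) + n mod 2 ^ j"
    using mod_mult2_eq[of n "2 ^ j" 2] by (simp add: mult.commute)
  moreover have "\<not> 2 ^ j \<le> n mod 2 ^ j"
    by (simp add: not_le)
  ultimately show ?thesis
    by (cases "odd (n div 2 ^ j)") (auto simp: bit_iff_odd odd_iff_mod_2_eq_one)
qed

lemma sum_bit_eq:
  "(\<Sum>i<n. of_bool (bit i j)) = real n / 2 - 2 ^ j * dist_to_int (real n / 2 ^ Suc j)"
proof -
  define M :: nat where "M = 2 ^ Suc j"
  have M: "M = 2 * 2 ^ j" "M > 0"
    by (simp_all add: M_def)
  \<comment> \<open>The factor 1/2 is \<open>2 ^ j / M\<close>. In the induction,
    \<open>n / 2\<close> grows by 1/2 and this term changes by 1/2 up or down, so the difference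
    grows by 0 or 1.\<close>
  have dist: "2 ^ j * dist_to_int (real m / 2 ^ Suc j)
      = min (real (m mod M)) (real M - real (m mod M)) / 2" for m
    using dist_to_int_divide_nat[OF M(2), of m] by (simp add: M_def)
  show ?thesis
    unfolding dist
  proof (induction n)
    case 0
    then show ?case by simp
  next
    case (Suc n)
    have bit: "bit n j \<longleftrightarrow> 2 ^ j \<le> n mod M"
      by (simp only: bit_iff_half_le_mod M_def)
    have M': "real M = 2 * real (2 ^ j)"
      by (simp add: M(1))
    show ?case
    proof (cases "bit n j")
      case True
      then have r: "real (2 ^ j) \<le> real (n mod M)"
        by (simp only: bit of_nat_le_iff)
      have "min (real (Suc n mod M)) (real M - real (Suc n mod M)) = real M - real (n mod M) - 1"
      \<comment> \<open>Descending half: at the last residue, \<open>M - 1\<close>, the successor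
        wraps to 0, which is also the value the descent reaches.\<close>
      proof (cases "Suc (n mod M) = M")
        case True
        then have "real (n mod M) + 1 = real M"
          by (metis of_nat_Suc add.commute)
        with True show ?thesis
          by (simp add: mod_Suc)
      next
        case False
        then have "real (Suc n mod M) = real (n mod M) + 1"
          by (simp add: mod_Suc)
        with r M' show ?thesis
          by linarith
      qed
      moreover have "min (real (n mod M)) (real M - real (n mod M)) = real M - real (n mod M)"
        using r M' by linarith
      ultimately show ?thesis
        using True Suc.IH by (simp add: field_simps)
    next
      case False
      then have r: "Suc (n mod M) \<le> 2 ^ j"
        by (simp add: bit)
      \<comment> \<open>Ascending half: the successor is at most the peak \<open>2 ^ j\<close>,
        which is below \<open>M\<close>, so no wrap-around occurs.\<close>
      moreover have "Suc (n mod M) \<noteq> M"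
        using r M by linarith
      ultimately have "min (real (Suc n mod M)) (real M - real (Suc n mod M)) = real (n mod M) + 1"
        using r[unfolded of_nat_le_iff[where 'a = real, symmetric]] M' by (simp add: mod_Suc)
      moreover have "min (real (n mod M)) (real M - real (n mod M)) = real (n mod M)"
        using r[unfolded of_nat_le_iff[where 'a = real, symmetric]] M' by simp
      ultimately show ?thesis
        using False Suc.IH by (simp add: field_simps)
    qed
  qed
qed

text \<open>A cutoff common to all \<open>i < 2 ^ K\<close> makes the digit range independent of
  \<open>i\<close>, which allows the two sums to be swapped in
  \<open>q_digit_sum_total_eq\<close>.\<close>

lemma q_digit_sum_eq_sum_lessThan:
  assumes "i < 2 ^ K"
  shows "q_digit_sum q i = (\<Sum>j<K. of_bool (bit i j) * q ^ (j + 1))"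
  unfolding q_digit_sum_def
proof (rule suminf_finite)
  fix j assume "j \<notin> {..<K}"
  then have "i < 2 ^ j"
    using assms power_increasing[of K j "2 :: nat"] by (simp del: power_increasing_iff)
  then show "of_bool (bit i j) * q ^ (j + 1) = 0"
    by (simp add: bit_iff_odd)
qed simp

lemma q_digit_sum_total_eq:
  assumes "n \<le> 2 ^ K"
  shows "q_digit_sum_total q n
    = (\<Sum>j<K. q ^ (j + 1) * (real n / 2 - 2 ^ j * dist_to_int (real n / 2 ^ Suc j)))"
proof -
  have "q_digit_sum_total q n = (\<Sum>i<n. \<Sum>j<K. of_bool (bit i j) * q ^ (j + 1))"
    unfolding q_digit_sum_total_def using assms
    by (intro sum.cong refl q_digit_sum_eq_sum_lessThan) simp
  also have "\<dots> = (\<Sum>j<K. q ^ (j + 1) * (\<Sum>i<n. of_bool (bit i j)))"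
    by (subst sum.swap) (simp add: sum_distrib_left mult.commute)
  finally show ?thesis
    by (simp only: sum_bit_eq)
qed

lemma takagi_landsberg_dyadic:
  "takagi_landsberg a (real n / 2 ^ K) = (\<Sum>m<K. a ^ m * dist_to_int (real n / 2 ^ (K - m)))"
proof -
  have "takagi_landsberg a (real n / 2 ^ K) = (\<Sum>m<K. a ^ m * dist_to_int (2 ^ m * (real n / 2 ^ K)))"
    unfolding takagi_landsberg_def
  proof (rule suminf_finite)
    fix m assume "m \<notin> {..<K}"
    \<comment> \<open>Here \<open>m \<ge> K\<close>, so the natural subtraction is exact and the
      argument of tau becomes an integer.\<close>
    then have "(2 :: real) ^ m = 2 ^ (m - K) * 2 ^ K"
      by (simp flip: power_add)
    then have "2 ^ m * (real n / 2 ^ K) = real (n * 2 ^ (m - K))"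
      by simp
    then show "a ^ m * dist_to_int (2 ^ m * (real n / 2 ^ K)) = 0"
      by (simp only: dist_to_int_of_nat mult_zero_right)
  qed simp
  also have "\<dots> = (\<Sum>m<K. a ^ m * dist_to_int (real n / 2 ^ (K - m)))"
    by (intro sum.cong refl) (simp add: power_diff mult.commute)
  finally show ?thesis .
qed

lemma q_digit_sum_total_takagi:
  fixes q :: real
  assumes "q \<noteq> 0" "q \<noteq> 1" "n \<le> 2 ^ Suc k"
  shows "q_digit_sum_total q n = q / 2 * (real n * ((1 - q ^ (k + 1)) / (1 - q))
    - q ^ k * 2 ^ Suc k * takagi_landsberg (1 / (2 * q)) (real n / 2 ^ Suc k))"
proof -
  have "q ^ k * 2 ^ Suc k * takagi_landsberg (1 / (2 * q)) (real n / 2 ^ Suc k)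
      = (\<Sum>m<Suc k. 2 * (2 * q) ^ (k - m) * dist_to_int (real n / 2 ^ Suc (k - m)))"
    unfolding takagi_landsberg_dyadic sum_distrib_left
  proof (intro sum.cong refl)
    fix m assume "m \<in> {..<Suc k}"
    then have m: "m \<le> k" "Suc k - m = Suc (k - m)"
      by auto
    \<comment> \<open>The prefactor is \<open>2 * (2 * q) ^ k\<close>, which turns the negative
      powers of \<open>2 * q\<close> into nonnegative ones since \<open>m \<le> k\<close>.\<close>
    have "q ^ k * 2 ^ Suc k * (1 / (2 * q)) ^ m = 2 * (2 * q) ^ (k - m)"
      using m(1) assms(1) by (simp add: power_diff power_mult_distrib power_divide)
    then show "q ^ k * 2 ^ Suc k * ((1 / (2 * q)) ^ m * dist_to_int (real n / 2 ^ (Suc k - m)))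
        = 2 * (2 * q) ^ (k - m) * dist_to_int (real n / 2 ^ Suc (k - m))"
      unfolding m(2) by (simp only: mult.assoc[symmetric])
  qed
  also have "\<dots> = (\<Sum>j<Suc k. 2 * (2 * q) ^ j * dist_to_int (real n / 2 ^ Suc j))"
    using sum.nat_diff_reindex[of "\<lambda>j. 2 * (2 * q) ^ j * dist_to_int (real n / 2 ^ Suc j)" "Suc k"]
    by (simp only: diff_Suc_Suc)
  finally have takagi: "q ^ k * 2 ^ Suc k * takagi_landsberg (1 / (2 * q)) (real n / 2 ^ Suc k)
      = (\<Sum>j<Suc k. 2 * (2 * q) ^ j * dist_to_int (real n / 2 ^ Suc j))" .
  have geometric: "(1 - q ^ (k + 1)) / (1 - q) = (\<Sum>j<Suc k. q ^ j)"
    using assms(2) by (simp only: sum_gp_strict if_False Suc_eq_plus1)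
  show ?thesis
    \<comment> \<open>Both sides are now sums over \<open>j < Suc k\<close> and agree term by term:
      \<open>q / 2\<close> times \<open>n * q ^ j\<close> minus \<open>2 * (2 * q) ^ j\<close> times
      tau is the contribution of digit \<open>j\<close>.\<close>
    unfolding q_digit_sum_total_eq[OF assms(3)] takagi geometric sum_distrib_left
      sum_subtractf[symmetric]
    by (intro sum.cong refl) (simp add: field_simps power_mult_distrib)
qed

theorem theorem1:
  fixes q a u :: real and n k :: nat
  assumes "\<bar>q\<bar> > 1 / 2" and "q \<noteq> 1" and "n \<ge> 1"
    and "a = 1 / (2 * q)"
    and "k = nat \<lfloor>log 2 (real n)\<rfloor>"
    and "u = log 2 (real n) - real k"
  shows "0 \<le> u \<and> u < 1 \<and>
    1 / real n * q_digit_sum_total q n =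
      q / 2 * ((1 - q ^ (k + 1)) / (1 - q)
        - q ^ k * (2 powr (1 - u) * takagi_landsberg a (2 powr (- (1 - u))))) \<and>
    1 / real n * q_digit_sum_total q n =
      q / 2 * ((1 - q ^ (k + 1)) / (1 - q) - q ^ k * F_hat q (log 2 (real n)))"
proof -
  have "log 2 (real n) \<ge> 0"
    using assms(3) by simp
  \<comment> \<open>Since \<open>n \<ge> 1\<close>, the logarithm is nonnegative and
    \<open>nat\<close> does not truncate.\<close>
  then have k: "real k = of_int \<lfloor>log 2 (real n)\<rfloor>"
    using assms(5) by simp
  have u: "u = frac (log 2 (real n))"
    using assms(6) k by (simp add: frac_def)
  have u01: "0 \<le> u" "u < 1"
    using u by (simp_all add: frac_lt_1)
  \<comment> \<open>Identifies \<open>2 powr (- (1 - u))\<close> with the dyadic point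
    \<open>n / 2 ^ Suc k\<close>; its reciprocal is the factor \<open>2 ^ Suc k / n\<close> left
    after dividing by \<open>n\<close>.\<close>
  have "1 - u = real (Suc k) - log 2 (real n)"
    using assms(6) by simp
  then have powr: "2 powr (1 - u) = 2 ^ Suc k / real n"
    using assms(3) by (simp only: powr_diff powr_realpow) simp
  then have powr': "2 powr (- (1 - u)) = real n / 2 ^ Suc k"
    by (simp only: powr_minus inverse_divide)
  have "log 2 (real n) < real (Suc k)"
    using u01 assms(6) by simp
  then have "real n < 2 powr real (Suc k)"
    using assms(3) by (subst (asm) log_less_iff) simp_all
  then have "real n < real (2 ^ Suc k)"
    by (simp only: powr_realpow of_nat_power of_nat_numeral zero_less_numeral)
  then have "n \<le> 2 ^ Suc k"
    by (simp only: of_nat_less_iff)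
  moreover have "q \<noteq> 0"
    using assms(1) by auto
  ultimately have "1 / real n * q_digit_sum_total q n =
      q / 2 * ((1 - q ^ (k + 1)) / (1 - q)
        - q ^ k * (2 powr (1 - u) * takagi_landsberg a (2 powr (- (1 - u)))))"
    unfolding powr powr' assms(4)
    using assms(2,3) by (subst q_digit_sum_total_takagi[of q n k]) (simp_all add: right_diff_distrib)
  then show ?thesis
    using u01 unfolding F_hat_def u[symmetric] assms(4) by blast
qed

end
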